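(* Let $\alpha$ be a weak composition of length $n$. Then \[\tilde{\mathcal{A}}_\alpha(x_1,\ldots,x_n)=\sum_{\alpha\trianglelefteq\beta\trianglelefteq\operatorname{qshift}(\alpha)}x^\beta,\] where the sum is over weak compositions $\beta$ of length $n$.
   Context: A weak composition of length $n$ is $\alpha=(\alpha_1,\ldots,\alpha_n)\in\mathbb{Z}_{\ge0}^n$; $x^\alpha=x_1^{\alpha_1}\cdots x_n^{\alpha_n}$. The flat $\operatorname{flat}(\alpha)$ is obtained by moving all zero entries of $\alpha$ to the right end (keeping the order of the nonzero entries). $S_n$ acts on length-$n$ vectors with $s_i$ exchanging the entries in positions $i$ and $i+1$; $w_\alpha\in S_n$ is a permutation of minimal length with $w_\alpha(\alpha)=\operatorname{flat}(\alpha)$. Dominance order: $\beta\trianglelefteq\gamma$ iff $\beta_1+\cdots+\beta_j\le\gamma_1+\cdots+\gamma_j$ for all $j$. Quasisymmetric action: $\tilde{s}_i(\beta)$ exchanges the entries in positions $i,i+1$ if $\beta_i=0$ or $\beta_{i+1}=0$, and fixes $\beta$ otherwise. For $1\le i\le n-1$ define linear operators on $\mathbb{C}[x_1,\ldots,x_n]$ by $\tilde{\pi}_i(x^\beta)=\dfrac{x_ix^\beta-x_{i+1}x^{\tilde{s}_i(\beta)}}{x_i-x_{i+1}}$ and $\tilde{\theta}_i=\tilde{\pi}_i-1$. For $w\in S_n$ with reduced word $w=s_{i_1}\cdots s_{i_k}$ set $\tilde{\theta}_w=\tilde{\theta}_{i_1}\cdots\tilde{\theta}_{i_k}$ (independent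 of the reduced word, since the $\tilde\theta_i$ satisfy the braid relations). The fundamental Demazure atom is $\tilde{\mathcal{A}}_\alpha=\tilde{\theta}_{w_\alpha^{-1}}x^{\operatorname{flat}(\alpha)}$. Fundamental shift: for $v=(v_1,\ldots,v_n)$ with nonnegative integer entries, let $S=\{i_1<\cdots<i_k\}$ be the positions of nonzero entries. Then $\operatorname{qshift}(v)=(w_1,\ldots,w_n)$ where: (1) for $j\in S$, $w_j=v_j$ if $j=1$ or $j-1\in S$, and $w_j=1$ otherwise; (2) if $i_j\in S$, $j<k$, $i_j+1\notin S$, then $w_{i_j+1}=v_{i_{j+1}}-1$; (3) if $1\notin S$ (and $S\ne\emptyset$), $w_1=v_{i_1}-1$; (4) all other $w_j=0$. Example: $\operatorname{qshift}(0,0,3,0,1,4,0,5)=(2,0,1,0,1,4,4,1)$. *)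

theory Defs
  imports Complex_Main "HOL-Library.Poly_Mapping" "HOL-Combinatorics.Permutations"
begin

(* Vectors of nonnegative integers are finitely supported maps on nat, with positions
   numbered from 1 as in the text. A weak composition of length n is one supported on {1..n};
   it doubles as the exponent vector of a monomial in x_1, ..., x_n. *)

type_synonym expvec = "nat \<Rightarrow>\<^sub>0 nat"
type_synonym cpoly = "expvec \<Rightarrow>\<^sub>0 complex"

definition weak_composition :: "nat \<Rightarrow> expvec \<Rightarrow> bool" where
  "weak_composition n \<alpha> \<longleftrightarrow> Poly_Mapping.keys \<alpha> \<subseteq> {1..n}"

definition X :: "nat \<Rightarrow> cpoly" where
  "X i = Poly_Mapping.single (Poly_Mapping.single i 1) 1"

definition xpow :: "expvec \<Rightarrow> cpoly" where
  "xpow \<beta> = Poly_Mapping.single \<beta> 1"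

definition scale :: "complex \<Rightarrow> cpoly \<Rightarrow> cpoly" where
  "scale c p = Poly_Mapping.single 0 c * p"

(* Poly_Mapping.nth places a list at positions 0, 1, ...; the leading 0 fills the unused
   position 0, so the nonzero entries of \<alpha>, in order, land at positions 1, 2, .... *)
definition flat :: "expvec \<Rightarrow> expvec" where
  "flat \<alpha> = Poly_Mapping.nth
     (0 # map (Poly_Mapping.lookup \<alpha>) (sorted_list_of_set (Poly_Mapping.keys \<alpha>)))"

definition dominated :: "nat \<Rightarrow> expvec \<Rightarrow> expvec \<Rightarrow> bool" where
  "dominated n \<beta> \<gamma> \<longleftrightarrow>
     (\<forall>j\<in>{1..n}. (\<Sum>i=1..j. Poly_Mapping.lookup \<beta> i) \<le> (\<Sum>i=1..j. Poly_Mapping.lookup \<gamma> i))"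

abbreviation simple_transp :: "nat \<Rightarrow> nat \<Rightarrow> nat" where
  "simple_transp i \<equiv> transpose i (Suc i)"

(* The left action by permuting positions: the entry in position j moves to position w j. *)
definition act :: "(nat \<Rightarrow> nat) \<Rightarrow> expvec \<Rightarrow> expvec" where
  "act w \<beta> = Poly_Mapping.map_key (inv w) \<beta>"

lemma lookup_act:
  assumes "bij w"
  shows "Poly_Mapping.lookup (act w \<beta>) j = Poly_Mapping.lookup \<beta> (inv w j)"
  using assms by (simp add: act_def map_key.rep_eq bij_imp_bij_inv bij_is_inj)

definition word_perm :: "nat list \<Rightarrow> nat \<Rightarrow> nat" where
  "word_perm is = foldr (\<lambda>i f. simple_transp i \<circ> f) is id"

definition perm_length :: "nat \<Rightarrow> (nat \<Rightarrow> nat) \<Rightarrow> nat" where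
  "perm_length n w = (LEAST k. \<exists>is. set is \<subseteq> {1..<n} \<and> length is = k \<and> word_perm is = w)"

definition reduced_word :: "nat \<Rightarrow> (nat \<Rightarrow> nat) \<Rightarrow> nat list \<Rightarrow> bool" where
  "reduced_word n w is \<longleftrightarrow>
     set is \<subseteq> {1..<n} \<and> word_perm is = w \<and> length is = perm_length n w"

definition w_comp :: "nat \<Rightarrow> expvec \<Rightarrow> nat \<Rightarrow> nat" where
  "w_comp n \<alpha> = (ARG_MIN (perm_length n) w. w permutes {1..n} \<and> act w \<alpha> = flat \<alpha>)"

definition qs_transp :: "nat \<Rightarrow> expvec \<Rightarrow> expvec" where
  "qs_transp i \<beta> =
     (if Poly_Mapping.lookup \<beta> i = 0 \<or> Poly_Mapping.lookup \<beta> (Suc i) = 0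
      then act (simple_transp i) \<beta> else \<beta>)"

(* The quotient is characterised by its defining equation; it exists and is unique,
   see ex1_pi_monom below. *)
definition pi_monom :: "nat \<Rightarrow> expvec \<Rightarrow> cpoly" where
  "pi_monom i \<beta> =
     (THE q. (X i - X (Suc i)) * q = X i * xpow \<beta> - X (Suc i) * xpow (qs_transp i \<beta>))"

definition pi_op :: "nat \<Rightarrow> cpoly \<Rightarrow> cpoly" where
  "pi_op i p = (\<Sum>\<beta>\<in>Poly_Mapping.keys p. scale (Poly_Mapping.lookup p \<beta>) (pi_monom i \<beta>))"

definition theta_op :: "nat \<Rightarrow> cpoly \<Rightarrow> cpoly" where
  "theta_op i p = pi_op i p - p"

definition theta_word :: "nat list \<Rightarrow> cpoly \<Rightarrow> cpoly" where
  "theta_word is = foldr (\<lambda>i f. theta_op i \<circ> f) is id"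

(* Any reduced word may be used: the operators theta_op i satisfy the braid relations. *)
definition theta_perm :: "nat \<Rightarrow> (nat \<Rightarrow> nat) \<Rightarrow> cpoly \<Rightarrow> cpoly" where
  "theta_perm n w = theta_word (SOME is. reduced_word n w is)"

definition fundamental_atom :: "nat \<Rightarrow> expvec \<Rightarrow> cpoly" where
  "fundamental_atom n \<alpha> = theta_perm n (inv (w_comp n \<alpha>)) (xpow (flat \<alpha>))"

(* The positions j outside the support S that receive "the next nonzero entry minus 1" are
   j = 1 and the right neighbours of elements of S, provided a later element of S exists. *)
lift_definition qshift :: "expvec \<Rightarrow> expvec" is
  "\<lambda>v j. let S = {i. v i \<noteq> 0} in
     if j \<in> S then (if j = 1 \<or> j - 1 \<in> S then v j else 1)
     else if (j = 1 \<or> j - 1 \<in> S) \<and> (\<exists>i\<in>S. j < i) then v (Min {i \<in> S. j < i}) - 1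
     else 0"
proof -
  fix v :: "nat \<Rightarrow> nat"
  assume fin: "finite {i. v i \<noteq> 0}"
  let ?S = "{i. v i \<noteq> 0}"
  have "{j. (let S = ?S in
      if j \<in> S then (if j = 1 \<or> j - 1 \<in> S then v j else 1)
      else if (j = 1 \<or> j - 1 \<in> S) \<and> (\<exists>i\<in>S. j < i) then v (Min {i \<in> S. j < i}) - 1
      else 0) \<noteq> 0} \<subseteq> ?S \<union> (\<Union>i\<in>?S. {..<i})"
    by (auto simp: Let_def split: if_splits)
  then show "finite {j. (let S = ?S in
      if j \<in> S then (if j = 1 \<or> j - 1 \<in> S then v j else 1)
      else if (j = 1 \<or> j - 1 \<in> S) \<and> (\<exists>i\<in>S. j < i) then v (Min {i \<in> S. j < i}) - 1
      else 0) \<noteq> 0}"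
    by (rule finite_subset) (use fin in simp)
qed

lemma pow_diff_dvd: "(a - b :: 'a::comm_ring_1) dvd a ^ k - b ^ k"
proof (induction k)
  case (Suc k)
  have "a ^ Suc k - b ^ Suc k = a * (a ^ k - b ^ k) + (a - b) * b ^ k"
    by (simp add: algebra_simps)
  moreover have "a - b dvd a * (a ^ k - b ^ k)"
    using Suc by (rule dvd_mult)
  ultimately show ?case by (simp only: dvd_add dvd_triv_left)
qed simp

lemma swap_diff_dvd:
  fixes x y :: "'a::comm_ring_1"
  assumes "a = 0 \<or> b = 0"
  shows "x - y dvd x * (x ^ a * y ^ b) - y * (x ^ b * y ^ a)"
proof (cases "b = 0")
  case True
  then show ?thesis using pow_diff_dvd[of x y "Suc a"] by simp
next
  case False
  then obtain c where c: "b = Suc c" "a = 0"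
    using assms not0_implies_Suc by blast
  have "x * (x ^ a * y ^ b) - y * (x ^ b * y ^ a) = (x ^ c - y ^ c) * (- (x * y))"
    by (simp add: c algebra_simps)
  then show ?thesis using pow_diff_dvd[of x y c] by (metis dvd_mult2)
qed

lemma X_pow: "X i ^ k = Poly_Mapping.single (Poly_Mapping.single i k) 1"
  by (induction k) (simp_all add: X_def mult_single single_add[symmetric])

lemma ex1_pi_monom:
  "\<exists>!q. (X i - X (Suc i)) * q = X i * xpow \<beta> - X (Suc i) * xpow (qs_transp i \<beta>)"
proof -
  let ?j = "Suc i"
  let ?L = Poly_Mapping.lookup
  let ?a = "?L \<beta> i" and ?b = "?L \<beta> ?j"
  define m where "m = Poly_Mapping.update i 0 (Poly_Mapping.update ?j 0 \<beta>)"
  have lm: "?L m k = (if k = i \<or> k = ?j then 0 else ?L \<beta> k)" for k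
    by (simp add: m_def update.rep_eq)
  have \<beta>: "\<beta> = m + Poly_Mapping.single i ?a + Poly_Mapping.single ?j ?b"
    by (rule poly_mapping_eqI) (auto simp: lookup_add lm lookup_single when_def)
  have s\<beta>: "act (simple_transp i) \<beta> = m + Poly_Mapping.single i ?b + Poly_Mapping.single ?j ?a"
    by (rule poly_mapping_eqI)
      (auto simp: lookup_add lm lookup_single when_def lookup_act transpose_def)
  have xm: "xpow (m + Poly_Mapping.single i k + Poly_Mapping.single ?j l)
      = xpow m * X i ^ k * X ?j ^ l" for k l
    by (simp add: X_pow xpow_def mult_single)
  have x\<beta>: "xpow \<beta> = xpow m * X i ^ ?a * X ?j ^ ?b"
    by (metis \<beta> xm)
  have xs\<beta>: "xpow (act (simple_transp i) \<beta>) = xpow m * X i ^ ?b * X ?j ^ ?a"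
    by (metis s\<beta> xm)
  have "X i - X ?j dvd X i * xpow \<beta> - X ?j * xpow (qs_transp i \<beta>)"
  proof (cases "?a = 0 \<or> ?b = 0")
    case False
    then show ?thesis by (simp add: qs_transp_def left_diff_distrib[symmetric])
  next
    case True
    then have *: "X i * xpow \<beta> - X ?j * xpow (qs_transp i \<beta>)
        = xpow m * (X i * (X i ^ ?a * X ?j ^ ?b) - X ?j * (X i ^ ?b * X ?j ^ ?a))"
      by (simp add: qs_transp_def x\<beta> xs\<beta> algebra_simps)
    have "X i - X ?j dvd X i * (X i ^ ?a * X ?j ^ ?b) - X ?j * (X i ^ ?b * X ?j ^ ?a)"
      using True by (rule swap_diff_dvd)
    then show ?thesis unfolding * by (rule dvd_mult)
  qed
  then obtain q where q: "X i * xpow \<beta> - X ?j * xpow (qs_transp i \<beta>) = (X i - X ?j) * q"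
    by (rule dvdE)
  have "X i - X ?j \<noteq> 0"
  proof
    assume "X i - X ?j = 0"
    then have "?L (X i) (Poly_Mapping.single i 1) = ?L (X ?j) (Poly_Mapping.single i 1)"
      by simp
    moreover have "Poly_Mapping.single ?j (1::nat) \<noteq> Poly_Mapping.single i 1"
      by (metis lookup_single_eq lookup_single_not_eq n_not_Suc_n one_neq_zero)
    ultimately show False by (simp add: X_def lookup_single)
  qed
  then have "p = q" if "(X i - X ?j) * p = (X i - X ?j) * q" for p
    using that by (rule mult_left_cancel[THEN iffD1])
  then show ?thesis
    unfolding q by blast
qed

end

theory Submission
  imports Defs
begin

text \<open>
  Write \<open>P\<^sub>q\<close> for the partial sum of the first \<open>q\<close> entries. The interval between \<open>\<alpha>\<close> and
  \<open>qshift \<alpha>\<close> consists of the \<open>\<beta>\<close> of the same size with \<open>\<beta>\<^sub>q > 0\<close> and \<open>P\<^sub>q(\<beta>) = P\<^sub>q(\<alpha>)\<close>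
  at every position \<open>q\<close> in the support of \<open>\<alpha>\<close>. In this form one sees that the \<open>i\<close>-th operator
  turns the sum of monomials for \<open>\<gamma>\<close> into the one for \<open>s\<^sub>i \<gamma>\<close> whenever \<open>\<gamma>\<^sub>i > 0 = \<gamma>\<^sub>i\<^sub>+\<^sub>1\<close>.
  A simple transposition raises the sum of the positions of the nonzero entries by at most one,
  and by exactly one in just that situation. Sorting \<open>\<alpha>\<close> shows that the shortest permutations
  taking \<open>flat \<alpha>\<close> to \<open>\<alpha>\<close> are no longer than the total rise, so each letter of a reduced word
  raises this sum by one.
\<close>

abbreviation lk :: "expvec \<Rightarrow> nat \<Rightarrow> nat" where
  "lk \<equiv> Poly_Mapping.lookup"

subsection \<open>Words in the simple transpositions\<close>

lemma lookup_act_transp: "lk (act (simple_transp i) \<beta>) j = lk \<beta> (simple_transp i j)"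
  by (simp add: lookup_act)

lemma act_comp:
  assumes "bij f" "bij g"
  shows "act (f \<circ> g) \<beta> = act f (act g \<beta>)"
  by (rule poly_mapping_eqI) (simp add: lookup_act assms bij_comp o_inv_distrib)

lemma act_id [simp]: "act id \<beta> = \<beta>"
  by (rule poly_mapping_eqI) (simp add: lookup_act)

lemma act_inv_eq:
  assumes "bij w" "act w \<alpha> = \<beta>"
  shows "act (inv w) \<beta> = \<alpha>"
  using act_comp[of "inv w" w \<alpha>] assms by (simp add: bij_imp_bij_inv bij_is_inj)

lemma keys_act_transp:
  "Poly_Mapping.keys (act (simple_transp i) \<beta>) = simple_transp i ` Poly_Mapping.keys \<beta>"
proof -
  have "a \<in> simple_transp i ` Poly_Mapping.keys \<beta>"
    if "simple_transp i a \<in> Poly_Mapping.keys \<beta>" for a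
    using that by (metis imageI transpose_involutory)
  then show ?thesis
    by (auto simp: in_keys_iff lookup_act_transp)
qed

lemma weak_composition_act_transp:
  assumes "weak_composition n \<beta>" "i \<in> {1..<n}"
  shows "weak_composition n (act (simple_transp i) \<beta>)"
  using assms by (auto simp: weak_composition_def keys_act_transp transpose_def)

lemma word_perm_Nil: "word_perm [] = id"
  by (simp add: word_perm_def)

lemma word_perm_Cons: "word_perm (i # is) = simple_transp i \<circ> word_perm is"
  by (simp add: word_perm_def)

lemma word_perm_append: "word_perm (is @ js) = word_perm is \<circ> word_perm js"
  by (induction "is") (simp_all add: word_perm_Nil word_perm_Cons fun_eq_iff)

lemma bij_word_perm [simp]: "bij (word_perm is)"
proof (induction "is")
  case Nil
  show ?case unfolding word_perm_Nil by (rule bij_id)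
next
  case (Cons i "is")
  then show ?case unfolding word_perm_Cons by (rule bij_comp) (rule bij_transpose)
qed

lemma word_perm_rev: "word_perm (rev is) = inv (word_perm is)"
proof (induction "is")
  case Nil
  show ?case by (metis inv_id rev.simps(1) word_perm_Nil)
next
  case (Cons i "is")
  have "inv (word_perm (i # is)) = inv (word_perm is) \<circ> simple_transp i"
    unfolding word_perm_Cons by (simp add: o_inv_distrib)
  also have "\<dots> = word_perm (rev is @ [i])"
    unfolding Cons.IH[symmetric] word_perm_append word_perm_Cons word_perm_Nil by simp
  finally show ?case by simp
qed

lemma word_perm_permutes: "set is \<subseteq> {1..<n} \<Longrightarrow> word_perm is permutes {1..n}"
proof (induction "is")
  case Nil
  show ?case unfolding word_perm_Nil by (rule permutes_id)
next
  case (Cons i "is")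
  then show ?case unfolding word_perm_Cons
    by (intro permutes_compose permutes_swap_id) auto
qed

lemma act_word_Nil: "act (word_perm []) \<beta> = \<beta>"
  by (simp add: word_perm_Nil)

lemma act_word_Cons:
  "act (word_perm (i # is)) \<beta> = act (simple_transp i) (act (word_perm is) \<beta>)"
  by (simp add: word_perm_Cons act_comp)

lemma weak_composition_act_word:
  assumes "weak_composition n \<beta>" "set is \<subseteq> {1..<n}"
  shows "weak_composition n (act (word_perm is) \<beta>)"
  using assms(2)
  by (induction "is")
    (use assms(1) in \<open>simp_all add: act_word_Nil act_word_Cons weak_composition_act_transp\<close>)

text \<open>The rightmost letter acts first, so \<open>n\<close> descends one step per letter until
  it reaches \<open>m\<close>. This cycle is what peels off the largest point in the next
  lemma.\<close>

lemma word_perm_upt: "m \<le> n \<Longrightarrow> word_perm [m..<n] n = m"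
proof (induction n)
  case (Suc n)
  then show ?case
    by (cases "m = Suc n") (simp_all add: word_perm_append word_perm_Nil word_perm_Cons)
qed (simp add: word_perm_Nil)

text \<open>If \<open>p\<close> sends \<open>m\<close> to the largest point, composing
  \<open>p\<close> with the cycle that carries the largest point to \<open>m\<close> fixes that
  point. The induction hypothesis gives a word for the composite, and the reversed word of the cycle
  undoes the composition.\<close>

lemma permutes_is_word_perm:
  "p permutes {1..n} \<Longrightarrow> \<exists>is. set is \<subseteq> {1..<n} \<and> word_perm is = p"
proof (induction n arbitrary: p)
  case 0
  then have "p = id" by simp
  then show ?case by (intro exI[of _ "[]"]) (metis empty_subsetI list.set(1) word_perm_Nil)
next
  case (Suc n)
  define m where "m = inv p (Suc n)"
  have "m \<in> {1..Suc n}"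
    unfolding m_def using permutes_in_image[OF permutes_inv[OF Suc.prems]] by simp
  then have m: "1 \<le> m" "m \<le> Suc n" by auto
  have pm: "p m = Suc n"
    unfolding m_def using Suc.prems by (rule permutes_inverses)
  define u where "u = word_perm [m..<Suc n]"
  have sub: "set [m..<Suc n] \<subseteq> {1..<Suc n}" using m by auto
  have pu: "p \<circ> u permutes {1..Suc n}"
    using word_perm_permutes[OF sub] Suc.prems by (simp add: u_def permutes_compose)
  have "(p \<circ> u) (Suc n) = Suc n"
    using m pm by (simp add: u_def word_perm_upt del: upt_Suc)
  then have "p \<circ> u permutes {1..n}"
    by (intro permutes_superset[OF pu]) (auto simp: le_Suc_eq)
  then obtain "is" where "is": "set is \<subseteq> {1..<n}" "word_perm is = p \<circ> u"
    using Suc.IH by blast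
  have "word_perm (is @ rev [m..<Suc n]) = p \<circ> (u \<circ> inv u)"
    by (simp only: word_perm_append word_perm_rev "is" u_def o_assoc)
  also have "\<dots> = p"
    using surj_iff[of u] bij_is_surj[OF bij_word_perm] by (simp add: u_def del: upt_Suc)
  finally have "word_perm (is @ rev [m..<Suc n]) = p" .
  moreover have "set (is @ rev [m..<Suc n]) \<subseteq> {1..<Suc n}"
    using "is"(1) sub by auto
  ultimately show ?case by blast
qed

lemma perm_length_le:
  assumes "set is \<subseteq> {1..<n}"
  shows "perm_length n (word_perm is) \<le> length is"
  unfolding perm_length_def by (rule Least_le) (use assms in blast)

lemma ex_reduced_word:
  assumes "p permutes {1..n}"
  shows "\<exists>is. reduced_word n p is"
proof -
  obtain "is" where "set is \<subseteq> {1..<n}" "word_perm is = p"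
    using permutes_is_word_perm[OF assms] by blast
  then have "\<exists>k is. set is \<subseteq> {1..<n} \<and> length is = k \<and> word_perm is = p"
    by blast
  from LeastI_ex[OF this] show ?thesis
    unfolding reduced_word_def perm_length_def by blast
qed

text \<open>Reversing a reduced word gives a word for the inverse. This is needed because
  \<open>w_comp\<close> is chosen of minimal length, while the atom is built from a reduced word of
  its inverse.\<close>

lemma perm_length_inv_le:
  assumes "p permutes {1..n}"
  shows "perm_length n (inv p) \<le> perm_length n p"
proof -
  obtain "is" where "reduced_word n p is"
    using ex_reduced_word[OF assms] by blast
  then have "set (rev is) \<subseteq> {1..<n}" "word_perm (rev is) = inv p" "length is = perm_length n p"
    by (auto simp: reduced_word_def word_perm_rev)
  then show ?thesis
    using perm_length_le[of "rev is" n] by simp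
qed

subsection \<open>Reduced words of the sorting permutation\<close>

text \<open>A potential that plays the role of length: for a weak composition it exceeds its value
  at \<open>flat \<beta>\<close> by the number of pairs of a zero entry and a later nonzero
  entry.\<close>

definition key_sum :: "expvec \<Rightarrow> nat" where
  "key_sum \<beta> = (\<Sum>b\<in>Poly_Mapping.keys \<beta>. b)"

text \<open>A key at \<open>i\<close> moves up by one and a key at \<open>Suc i\<close> moves down
  by one. The equation is additive so that no truncated subtraction occurs.\<close>

lemma key_sum_act_transp:
  "key_sum (act (simple_transp i) \<beta>) + (if lk \<beta> (Suc i) \<noteq> 0 then 1 else 0)
     = key_sum \<beta> + (if lk \<beta> i \<noteq> 0 then 1 else 0)"
proof -
  let ?K = "Poly_Mapping.keys \<beta>"
  have "key_sum (act (simple_transp i) \<beta>) = (\<Sum>b\<in>?K. simple_transp i b)"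
    unfolding key_sum_def keys_act_transp
    by (subst sum.reindex) simp_all
  moreover have "(\<Sum>b\<in>?K. simple_transp i b) + (\<Sum>b\<in>?K. if b = Suc i then 1 else 0)
      = (\<Sum>b\<in>?K. b) + (\<Sum>b\<in>?K. if b = i then 1 else (0::nat))"
    unfolding sum.distrib[symmetric]
    by (rule sum.cong) (auto simp: transpose_def)
  ultimately show ?thesis
    by (simp add: key_sum_def in_keys_iff)
qed

lemma sorted_list_of_set_image:
  fixes f :: "nat \<Rightarrow> nat"
  assumes "finite A" "strict_mono_on A f"
  shows "sorted_list_of_set (f ` A) = map f (sorted_list_of_set A)"
proof (rule sorted_distinct_set_unique)
  have "mono_on A f" using assms(2) by (rule strict_mono_on_imp_mono_on)
  then show "sorted (map f (sorted_list_of_set A))"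
    using assms(1) unfolding sorted_map
    by (intro sorted_wrt_mono_rel[OF _ sorted_sorted_list_of_set]) (auto simp: mono_on_def)
  show "distinct (map f (sorted_list_of_set A))"
    using assms strict_mono_on_imp_inj_on by (auto simp: distinct_map)
qed (use assms in auto)

text \<open>Since \<open>i\<close> and \<open>Suc i\<close> are not both keys, the transposition is
  strictly increasing on the support, and the nonzero entries keep their order.\<close>

lemma flat_act_transp:
  assumes "lk \<beta> i = 0 \<or> lk \<beta> (Suc i) = 0"
  shows "flat (act (simple_transp i) \<beta>) = flat \<beta>"
proof -
  have "strict_mono_on (Poly_Mapping.keys \<beta>) (simple_transp i)"
  proof (rule strict_mono_onI)
    fix r s assume rs: "r \<in> Poly_Mapping.keys \<beta>" "s \<in> Poly_Mapping.keys \<beta>" "r < s"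
    then have "\<not> (r = i \<and> s = Suc i)"
      using assms by (auto simp: in_keys_iff)
    with rs(3) show "simple_transp i r < simple_transp i s"
      unfolding transpose_def by (simp split: if_split) linarith
  qed
  then have "sorted_list_of_set (simple_transp i ` Poly_Mapping.keys \<beta>)
      = map (simple_transp i) (sorted_list_of_set (Poly_Mapping.keys \<beta>))"
    by (simp add: sorted_list_of_set_image)
  then show ?thesis
    by (simp add: flat_def keys_act_transp comp_def lookup_act_transp)
qed

lemma flat_id:
  assumes "Poly_Mapping.keys \<beta> = {1..k}"
  shows "flat \<beta> = \<beta>"
proof (rule poly_mapping_eqI)
  fix j
  have "sorted_list_of_set {1..k} = [1..<Suc k]"
    by (metis atLeastLessThanSuc_atLeastAtMost sorted_list_of_set_range)
  then have "flat \<beta> = Poly_Mapping.nth (0 # map (lk \<beta>) [1..<Suc k])"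
    unfolding flat_def assms by simp
  moreover have "j \<notin> {1..k} \<Longrightarrow> lk \<beta> j = 0"
    using assms by (metis in_keys_iff)
  ultimately show "lk (flat \<beta>) j = lk \<beta> j"
    by (cases j) (auto simp: nth.rep_eq nth_default_def nth_append simp del: upt_Suc)
qed

text \<open>Describes where sorting stops: if no zero stands directly before a nonzero entry, the
  support is closed downwards within the positive positions.\<close>

lemma keys_initial_segment:
  assumes "weak_composition n \<beta>"
    and no_ascent: "\<And>i. i \<in> {1..<n} \<Longrightarrow> lk \<beta> i = 0 \<Longrightarrow> lk \<beta> (Suc i) = 0"
  shows "\<exists>k. Poly_Mapping.keys \<beta> = {1..k}"
proof -
  let ?K = "Poly_Mapping.keys \<beta>"
  have sub: "?K \<subseteq> {1..n}" using assms(1) by (simp add: weak_composition_def)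
  have down: "a \<in> ?K" if "a \<le> b" "1 \<le> a" "b \<in> ?K" for a b
    using that
  proof (induction rule: inc_induct)
    case (step m)
    have "Suc m \<in> ?K" using step by simp
    moreover have "m \<in> {1..<n}" using calculation sub step.hyps step.prems by auto
    ultimately show ?case using no_ascent[of m] by (auto simp: in_keys_iff)
  qed simp
  show ?thesis
  proof (cases "?K = {}")
    case True
    then show ?thesis by (intro exI[of _ 0]) simp
  next
    case False
    then have "Max ?K \<in> ?K" by simp
    then have "{1..Max ?K} \<subseteq> ?K"
      using down by (meson atLeastAtMost_iff subsetI)
    moreover have "?K \<subseteq> {1..Max ?K}"
      using sub Max_ge[OF finite_keys] by (meson atLeastAtMost_iff subset_iff)
    ultimately have "?K = {1..Max ?K}" by (rule equalityI[rotated])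
    then show ?thesis by blast
  qed
qed

text \<open>Bubble sort: as long as a zero stands directly before a nonzero entry, exchanging the
  two lowers \<open>key_sum\<close> by exactly one and leaves \<open>flat\<close> unchanged. The
  number of steps is therefore the total drop of \<open>key_sum\<close>.\<close>

lemma ex_sorting_word:
  assumes "weak_composition n \<beta>"
  shows "\<exists>is. set is \<subseteq> {1..<n} \<and> act (word_perm is) \<beta> = flat \<beta> \<and>
    (\<exists>k. Poly_Mapping.keys (flat \<beta>) = {1..k}) \<and> key_sum \<beta> = key_sum (flat \<beta>) + length is"
  using assms
proof (induction "key_sum \<beta>" arbitrary: \<beta> rule: less_induct)
  case less
  show ?case
  proof (cases "\<exists>i\<in>{1..<n}. lk \<beta> i = 0 \<and> lk \<beta> (Suc i) \<noteq> 0")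
    case True
    then obtain i where i: "i \<in> {1..<n}" "lk \<beta> i = 0" "lk \<beta> (Suc i) \<noteq> 0" by blast
    let ?\<gamma> = "act (simple_transp i) \<beta>"
    have ks: "key_sum \<beta> = Suc (key_sum ?\<gamma>)"
      using key_sum_act_transp[of i \<beta>] i by simp
    have fl: "flat ?\<gamma> = flat \<beta>" using i by (simp add: flat_act_transp)
    obtain "is" where "is": "set is \<subseteq> {1..<n}" "act (word_perm is) ?\<gamma> = flat \<beta>"
      "\<exists>k. Poly_Mapping.keys (flat \<beta>) = {1..k}" "key_sum ?\<gamma> = key_sum (flat \<beta>) + length is"
      using less.hyps[of ?\<gamma>] weak_composition_act_transp[OF less.prems i(1)] ks fl by auto
    \<comment> \<open>The first exchange becomes the last letter, because words act from the
      right.\<close>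
    have "act (word_perm (is @ [i])) \<beta> = flat \<beta>"
      using "is"(2) by (simp add: word_perm_append act_comp act_word_Nil act_word_Cons)
    then show ?thesis
      using "is" ks i(1) by (intro exI[of _ "is @ [i]"]) auto
  next
    case False
    then obtain k where k: "Poly_Mapping.keys \<beta> = {1..k}"
      using keys_initial_segment[OF less.prems] by blast
    then show ?thesis
      using flat_id[OF k] by (intro exI[of _ "[]"]) (auto simp: act_word_Nil)
  qed
qed

lemma key_sum_act_word_le: "key_sum (act (word_perm is) \<beta>) \<le> key_sum \<beta> + length is"
proof (induction "is")
  case (Cons i "is")
  then show ?case
    using key_sum_act_transp[of i "act (word_perm is) \<beta>"]
    by (simp add: act_word_Cons split: if_splits)
qed (simp add: act_word_Nil)

subsection \<open>The dominance interval\<close>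

definition psum :: "expvec \<Rightarrow> nat \<Rightarrow> nat" where
  "psum \<beta> j = (\<Sum>i=1..j. lk \<beta> i)"

lemma psum_0 [simp]: "psum \<beta> 0 = 0"
  by (simp add: psum_def)

lemma psum_Suc [simp]: "psum \<beta> (Suc j) = psum \<beta> j + lk \<beta> (Suc j)"
  by (simp add: psum_def)

lemma psum_mono: "i \<le> j \<Longrightarrow> psum \<beta> i \<le> psum \<beta> j"
  by (rule lift_Suc_mono_le[of "psum \<beta>"]) simp_all

lemma psum_const:
  assumes "i \<le> j" "\<And>k. i < k \<Longrightarrow> k \<le> j \<Longrightarrow> lk \<beta> k = 0"
  shows "psum \<beta> j = psum \<beta> i"
  using assms by (induction rule: dec_induct) simp_all

text \<open>Redistributing a fixed total between the adjacent positions \<open>i\<close> and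
  \<open>Suc i\<close> can alter only the partial sum at \<open>i\<close>.\<close>

lemma psum_eq:
  assumes "1 \<le> i" "lk \<beta> i + lk \<beta> (Suc i) = lk \<gamma> i + lk \<gamma> (Suc i)"
    and "\<And>k. k \<noteq> i \<Longrightarrow> k \<noteq> Suc i \<Longrightarrow> lk \<beta> k = lk \<gamma> k"
    and "j \<noteq> i"
  shows "psum \<beta> j = psum \<gamma> j"
proof -
  have below: "psum \<beta> k = psum \<gamma> k" if "k < i" for k
    using that by (induction k) (simp_all add: assms(3))
  have at: "psum \<beta> (Suc i) = psum \<gamma> (Suc i)"
    using below[of "i - 1"] assms(1,2) by (cases i) auto
  have "psum \<beta> k = psum \<gamma> k" if "Suc i \<le> k" for k
    using that by (induction k rule: nat_induct_at_least) (use at in \<open>simp_all add: assms(3)\<close>)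
  with below assms(4) show ?thesis
    by (metis Suc_leI linorder_neqE_nat)
qed

text \<open>For a weak composition \<open>\<gamma>\<close>, the keys of \<open>\<gamma>\<close> cut
  the positions into blocks, each ending at a key. A member has the same sum as
  \<open>\<gamma>\<close> on every block and a positive last entry there; after the last key it
  vanishes.\<close>

definition block_set :: "nat \<Rightarrow> expvec \<Rightarrow> expvec set" where
  "block_set n \<gamma> = {\<beta>. weak_composition n \<beta> \<and>
     (\<forall>q\<in>Poly_Mapping.keys \<gamma>. 0 < lk \<beta> q \<and> psum \<beta> q = psum \<gamma> q) \<and> psum \<beta> n = psum \<gamma> n}"

definition next_key :: "expvec \<Rightarrow> nat \<Rightarrow> nat" where
  "next_key \<alpha> j = Min {i \<in> Poly_Mapping.keys \<alpha>. j < i}"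

lemma
  assumes "\<exists>i\<in>Poly_Mapping.keys \<alpha>. j < i"
  shows next_key_in: "next_key \<alpha> j \<in> Poly_Mapping.keys \<alpha>"
    and next_key_gt: "j < next_key \<alpha> j"
    and lookup_below_next_key: "\<And>k. j < k \<Longrightarrow> k < next_key \<alpha> j \<Longrightarrow> lk \<alpha> k = 0"
proof -
  let ?A = "{i \<in> Poly_Mapping.keys \<alpha>. j < i}"
  have fin: "finite ?A" by simp
  have "?A \<noteq> {}" using assms by blast
  with fin have "next_key \<alpha> j \<in> ?A" unfolding next_key_def by (rule Min_in)
  then show "next_key \<alpha> j \<in> Poly_Mapping.keys \<alpha>" "j < next_key \<alpha> j" by auto
  show "lk \<alpha> k = 0" if "j < k" "k < next_key \<alpha> j" for k
    using that Min_le[OF fin, of k] by (fastforce simp: next_key_def in_keys_iff)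
qed

lemma next_key_Suc:
  assumes "Suc j \<notin> Poly_Mapping.keys \<alpha>"
  shows "next_key \<alpha> (Suc j) = next_key \<alpha> j"
proof -
  have "{i \<in> Poly_Mapping.keys \<alpha>. Suc j < i} = {i \<in> Poly_Mapping.keys \<alpha>. j < i}"
    using assms by (metis (no_types, lifting) Suc_lessD Suc_lessI)
  then show ?thesis by (simp add: next_key_def)
qed

lemma next_key_eq_Suc:
  assumes "Suc j \<in> Poly_Mapping.keys \<alpha>"
  shows "next_key \<alpha> j = Suc j"
  unfolding next_key_def by (rule Min_eqI) (use assms in auto)

lemma lookup_qshift:
  "lk (qshift v) j =
    (if j \<in> Poly_Mapping.keys v
     then (if j = 1 \<or> j - 1 \<in> Poly_Mapping.keys v then lk v j else 1)
     else if (j = 1 \<or> j - 1 \<in> Poly_Mapping.keys v) \<and> (\<exists>i\<in>Poly_Mapping.keys v. j < i)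
     then lk v (next_key v j) - 1 else 0)"
  by (auto simp: qshift.rep_eq Let_def next_key_def in_keys_iff)

definition qshift_excess :: "expvec \<Rightarrow> nat \<Rightarrow> nat" where
  "qshift_excess \<alpha> j =
     (if j = 0 \<or> j \<in> Poly_Mapping.keys \<alpha> \<or> \<not> (\<exists>i\<in>Poly_Mapping.keys \<alpha>. j < i) then 0
      else lk \<alpha> (next_key \<alpha> j) - 1)"

text \<open>A gap of zeros before a nonzero entry \<open>a\<close> receives \<open>a - 1\<close> at
  its first position, and the entry itself becomes 1. The surplus is thus \<open>a - 1\<close>
  throughout the gap and returns to 0 at the next key.\<close>

lemma psum_qshift: "psum (qshift \<alpha>) j = psum \<alpha> j + qshift_excess \<alpha> j"
proof (induction j)
  case 0
  then show ?case by (simp add: qshift_excess_def)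
next
  case (Suc j)
  let ?K = "Poly_Mapping.keys \<alpha>"
  show ?case
  proof (cases "Suc j \<in> ?K")
    case True
    then have "0 < lk \<alpha> (Suc j)" by (simp add: in_keys_iff)
    with True show ?thesis
      using Suc by (auto simp: lookup_qshift qshift_excess_def next_key_eq_Suc)
  next
    case False
    then have "lk \<alpha> (Suc j) = 0" by (simp add: in_keys_iff)
    moreover have "(\<exists>i\<in>?K. Suc j < i) \<longleftrightarrow> (\<exists>i\<in>?K. j < i)"
      using False by (metis Suc_lessD Suc_lessI)
    ultimately show ?thesis
      using False Suc by (simp add: lookup_qshift qshift_excess_def next_key_Suc)
  qed
qed

text \<open>The upper and lower bounds on the partial sums meet at the keys and at \<open>n\<close>,
  where the excess is 0. Inside a gap the upper bound amounts to leaving at least one unit for the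
  key that closes the gap.\<close>

lemma dominance_interval_eq_block_set:
  assumes "weak_composition n \<alpha>"
  shows "{\<beta>. weak_composition n \<beta> \<and> dominated n \<alpha> \<beta> \<and> dominated n \<beta> (qshift \<alpha>)}
    = block_set n \<alpha>"
proof -
  let ?K = "Poly_Mapping.keys \<alpha>"
  have dom: "dominated n \<beta> \<gamma> \<longleftrightarrow> (\<forall>j\<in>{1..n}. psum \<beta> j \<le> psum \<gamma> j)" for \<beta> \<gamma>
    by (simp add: dominated_def psum_def)
  have sub: "?K \<subseteq> {1..n}" using assms by (simp add: weak_composition_def)
  have excess_key: "qshift_excess \<alpha> q = 0" if "q \<in> ?K \<or> q = n" for q
    using that sub by (auto simp: qshift_excess_def)
  have "\<beta> \<in> block_set n \<alpha>"
    if \<beta>: "weak_composition n \<beta>" "dominated n \<alpha> \<beta>" "dominated n \<beta> (qshift \<alpha>)" for \<beta>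
  proof -
    \<comment> \<open>The trivial case \<open>j = 0\<close>, which \<open>dominated\<close> does not
      cover, is included for the sake of a key at position 1.\<close>
    have lower: "psum \<alpha> j \<le> psum \<beta> j" and upper: "psum \<beta> j \<le> psum \<alpha> j + qshift_excess \<alpha> j"
      if "j \<le> n" for j
      using \<beta> that by (cases j; force simp: dom psum_qshift)+
    have eq: "psum \<beta> q = psum \<alpha> q" if "q \<in> ?K \<or> q = n" for q
      using lower[of q] upper[of q] excess_key[OF that] that sub by fastforce
    have "0 < lk \<beta> q" if q: "q \<in> ?K" for q
    proof -
      obtain j where j: "q = Suc j" "Suc j \<le> n" using q sub by (cases q) auto
      have pos: "0 < lk \<alpha> (Suc j)" using q j by (simp add: in_keys_iff)
      \<comment> \<open>Just before a key the excess is 0 or that key's entry minus one, so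
        \<open>\<beta>\<close> cannot have reached the partial sum prescribed at the key.\<close>
      have "qshift_excess \<alpha> j \<le> lk \<alpha> (Suc j) - 1"
        using q by (simp add: qshift_excess_def j next_key_eq_Suc)
      then have "psum \<beta> j < psum \<alpha> (Suc j)"
        using upper[of j] j pos by simp
      then show ?thesis using eq[of q] q by (simp add: j)
    qed
    with eq \<beta>(1) show ?thesis by (simp add: block_set_def)
  qed
  moreover have "dominated n \<alpha> \<beta> \<and> dominated n \<beta> (qshift \<alpha>)" if "\<beta> \<in> block_set n \<alpha>" for \<beta>
  proof -
    have \<beta>: "0 < lk \<beta> q" "psum \<beta> q = psum \<alpha> q" if "q \<in> ?K" for q
      using \<open>\<beta> \<in> block_set n \<alpha>\<close> that by (simp_all add: block_set_def)
    have \<beta>n: "psum \<beta> n = psum \<alpha> n"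
      using \<open>\<beta> \<in> block_set n \<alpha>\<close> by (simp add: block_set_def)
    have "psum \<alpha> j \<le> psum \<beta> j" for j
    proof (induction j)
      case (Suc j)
      show ?case
      proof (cases "Suc j \<in> ?K")
        case True
        then show ?thesis by (metis \<beta>(2) order_refl)
      next
        case False
        then show ?thesis using Suc by (simp add: in_keys_iff)
      qed
    qed simp
    moreover have "psum \<beta> j \<le> psum \<alpha> j + qshift_excess \<alpha> j" if "j \<in> {1..n}" for j
    proof -
      consider "j \<in> ?K" | "j \<notin> ?K" "\<exists>i\<in>?K. j < i" | "\<not> (\<exists>i\<in>?K. j < i)" by blast
      then show ?thesis
      proof cases
        case 1
        then show ?thesis by (simp add: \<beta>)
      next
        case 2
        let ?r = "next_key \<alpha> j"
        \<comment> \<open>Up to \<open>t\<close>, the position just before the closing key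
          \<open>?r\<close>, \<open>\<beta>\<close> has spent at most the prescribed sum at
          \<open>?r\<close> minus the positive entry there, and its partial sum at \<open>j\<close>
          is no larger.\<close>
        obtain t where t: "?r = Suc t" "j \<le> t"
          using next_key_gt[OF 2(2)] by (cases ?r) auto
        have r: "?r \<in> ?K" using 2(2) by (rule next_key_in)
        have "psum \<alpha> t = psum \<alpha> j"
          using t by (intro psum_const lookup_below_next_key[OF 2(2)]) auto
        then have "psum \<beta> t < psum \<alpha> j + lk \<alpha> ?r"
          using \<beta>[OF r] unfolding t by simp
        moreover have "psum \<beta> j \<le> psum \<beta> t" using t(2) by (rule psum_mono)
        ultimately show ?thesis
          using 2 that by (simp add: qshift_excess_def)
      next
        case 3
        then have "psum \<alpha> n = psum \<alpha> j"
          using that by (intro psum_const) (auto simp: in_keys_iff)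
        moreover have "psum \<beta> j \<le> psum \<beta> n" using that by (intro psum_mono) auto
        ultimately show ?thesis using \<beta>n by simp
      qed
    qed
    ultimately show ?thesis by (simp add: dom psum_qshift)
  qed
  moreover have "weak_composition n \<beta>" if "\<beta> \<in> block_set n \<alpha>" for \<beta>
    using that by (simp add: block_set_def)
  ultimately show ?thesis by blast
qed

lemma finite_psum_eq: "finite {\<beta>. weak_composition n \<beta> \<and> psum \<beta> n = N}" (is "finite ?A")
proof (rule finite_imageD)
  have "lk \<beta> j \<in> {0..N}" if "\<beta> \<in> ?A" "j \<in> {1..n}" for \<beta> j
    using that member_le_sum[of j "{1..n}" "lk \<beta>"] by (auto simp: psum_def)
  moreover have "lk \<beta> j = 0" if "\<beta> \<in> ?A" "j \<notin> {1..n}" for \<beta> j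
    using that in_keys_iff[of j \<beta>] by (auto simp: weak_composition_def)
  ultimately have "lk ` ?A \<subseteq> {f. \<forall>x. (x \<in> {1..n} \<longrightarrow> f x \<in> {0..N}) \<and> (x \<notin> {1..n} \<longrightarrow> f x = 0)}"
    by (intro image_subsetI CollectI allI conjI impI)
  then show "finite (lk ` ?A)"
    by (rule finite_subset) (rule finite_set_of_finite_funs; simp)
  show "inj_on lk ?A"
    by (simp add: inj_on_def lookup_inject)
qed

lemma finite_block_set: "finite (block_set n \<gamma>)"
  by (rule finite_subset[OF _ finite_psum_eq[of n "psum \<gamma> n"]]) (auto simp: block_set_def)

lemma psum_eq_imp_eq:
  assumes "weak_composition n \<beta>" "weak_composition n \<gamma>" "\<And>j. j \<le> n \<Longrightarrow> psum \<beta> j = psum \<gamma> j"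
  shows "\<beta> = \<gamma>"
proof (rule poly_mapping_eqI)
  fix j
  show "lk \<beta> j = lk \<gamma> j"
  proof (cases "j \<in> {1..n}")
    case True
    then obtain t where "j = Suc t" "Suc t \<le> n" by (cases j) auto
    then show ?thesis using assms(3)[of t] assms(3)[of j] by simp
  next
    case False
    then have "j \<notin> Poly_Mapping.keys \<beta>" "j \<notin> Poly_Mapping.keys \<gamma>"
      using assms(1,2) by (auto simp: weak_composition_def)
    then show ?thesis by (simp add: in_keys_iff)
  qed
qed

text \<open>Without gaps every block has length one, so all entries are forced. This makes the
  monomial of \<open>flat \<alpha>\<close> the starting case for the operators.\<close>

lemma block_set_initial_segment:
  assumes wc: "weak_composition n \<gamma>" and keys: "Poly_Mapping.keys \<gamma> = {1..k}"
  shows "block_set n \<gamma> = {\<gamma>}"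
proof -
  have "\<beta> = \<gamma>" if \<beta>: "\<beta> \<in> block_set n \<gamma>" for \<beta>
  proof (rule psum_eq_imp_eq)
    show "weak_composition n \<beta>" using \<beta> by (simp add: block_set_def)
    have "k \<le> n" using wc keys by (cases "k = 0") (auto simp: weak_composition_def)
    have *: "psum \<beta> j = psum \<gamma> j" if "j \<le> k" for j
      using \<beta> keys that by (cases j) (auto simp: block_set_def simp del: psum_Suc)
    show "psum \<beta> j = psum \<gamma> j" if "j \<le> n" for j
    proof (cases "j \<le> k")
      case False
      have c: "psum \<gamma> m = psum \<gamma> k" if "k \<le> m" for m
        using that keys by (intro psum_const) (auto simp: not_in_keys_iff_lookup_eq_zero[symmetric])
      \<comment> \<open>Beyond \<open>k\<close> the partial sum is squeezed between its values at
        \<open>k\<close> and \<open>n\<close>, which agree.\<close>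
      have "psum \<beta> k \<le> psum \<beta> j" "psum \<beta> j \<le> psum \<beta> n"
        using False that by (auto intro: psum_mono)
      moreover have "psum \<beta> n = psum \<gamma> n" using \<beta> by (simp add: block_set_def)
      ultimately show ?thesis
        using c[of j] c[of n] *[of k] False \<open>k \<le> n\<close> by simp
    qed (rule *)
  qed fact
  moreover have "\<gamma> \<in> block_set n \<gamma>"
    using wc by (simp add: block_set_def in_keys_iff)
  ultimately show ?thesis by blast
qed

subsection \<open>The operators on sums of monomials\<close>

lemma X_mult_xpow: "X i * xpow \<beta> = xpow (\<beta> + Poly_Mapping.single i 1)"
  by (simp add: X_def xpow_def mult_single add.commute)

lemma X_diff_nonzero: "X i - X (Suc i) \<noteq> 0"
proof
  assume "X i - X (Suc i) = 0"
  then have "X i = X (Suc i)" by simp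
  then have "Poly_Mapping.lookup (X i) (Poly_Mapping.single i 1)
      = Poly_Mapping.lookup (X (Suc i)) (Poly_Mapping.single i 1)"
    by simp
  moreover have "Poly_Mapping.single (Suc i) (1::nat) \<noteq> Poly_Mapping.single i 1"
    by (metis lookup_single_eq lookup_single_not_eq n_not_Suc_n one_neq_zero)
  ultimately show False by (simp add: X_def lookup_single)
qed

lemma lookup_sum_xpow:
  assumes "finite A"
  shows "Poly_Mapping.lookup (\<Sum>\<beta>\<in>A. xpow \<beta>) \<mu> = (if \<mu> \<in> A then 1 else 0)"
  using assms by (simp add: lookup_sum xpow_def lookup_single when_def)

lemma pi_op_sum_xpow:
  assumes "finite A"
  shows "pi_op i (\<Sum>\<beta>\<in>A. xpow \<beta>) = (\<Sum>\<beta>\<in>A. pi_monom i \<beta>)"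
proof -
  have "Poly_Mapping.keys (\<Sum>\<beta>\<in>A. xpow \<beta>) = A"
    using lookup_sum_xpow[OF assms] by (auto simp: in_keys_iff split: if_splits)
  moreover have "scale 1 p = p" for p
    by (simp add: scale_def)
  ultimately show ?thesis
    by (simp add: pi_op_def lookup_sum_xpow[OF assms])
qed

text \<open>Multiplying by \<open>X i - X (Suc i)\<close> clears the denominator, so the quotients
  \<open>pi_monom\<close> never have to be computed; later identities are compared in this form and
  the nonzero factor is cancelled.\<close>

lemma theta_op_sum_xpow:
  assumes "finite A"
  shows "(X i - X (Suc i)) * theta_op i (\<Sum>\<beta>\<in>A. xpow \<beta>)
    = X (Suc i) * (\<Sum>\<beta>\<in>A. xpow \<beta> - xpow (qs_transp i \<beta>))"
proof -
  have pi: "(X i - X (Suc i)) * pi_monom i \<beta> = X i * xpow \<beta> - X (Suc i) * xpow (qs_transp i \<beta>)"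
    for \<beta>
    unfolding pi_monom_def using ex1_pi_monom by (rule theI')
  have "theta_op i (\<Sum>\<beta>\<in>A. xpow \<beta>) = (\<Sum>\<beta>\<in>A. pi_monom i \<beta> - xpow \<beta>)"
    by (simp add: theta_op_def pi_op_sum_xpow[OF assms] sum_subtractf)
  then have "(X i - X (Suc i)) * theta_op i (\<Sum>\<beta>\<in>A. xpow \<beta>)
      = (\<Sum>\<beta>\<in>A. (X i - X (Suc i)) * pi_monom i \<beta> - (X i - X (Suc i)) * xpow \<beta>)"
    by (simp add: sum_distrib_left right_diff_distrib)
  also have "\<dots> = (\<Sum>\<beta>\<in>A. X (Suc i) * (xpow \<beta> - xpow (qs_transp i \<beta>)))"
    unfolding pi by (rule sum.cong) (simp_all add: algebra_simps)
  finally show ?thesis by (simp add: sum_distrib_left)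
qed

text \<open>The map \<open>\<beta> \<mapsto> \<beta> + e\<^sub>i - e\<^sub>i\<^sub>+\<^sub>1\<close> turns \<open>x\<^sub>i\<close> times the sum over \<open>\<beta>\<^sub>i\<^sub>+\<^sub>1 > 0\<close> into \<open>x\<^sub>i\<^sub>+\<^sub>1\<close> times the
  sum over \<open>\<beta>\<^sub>i > 0\<close>; the monomials with both exponents positive then cancel.\<close>

lemma X_diff_mult_sum_xpow:
  assumes fin: "finite C"
    and closed: "\<And>\<beta> \<gamma>. \<beta> \<in> C \<Longrightarrow> lk \<beta> i + lk \<beta> (Suc i) = lk \<gamma> i + lk \<gamma> (Suc i) \<Longrightarrow>
      (\<And>k. k \<noteq> i \<Longrightarrow> k \<noteq> Suc i \<Longrightarrow> lk \<beta> k = lk \<gamma> k) \<Longrightarrow> \<gamma> \<in> C"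
  shows "(X i - X (Suc i)) * (\<Sum>\<beta> | \<beta> \<in> C \<and> 0 < lk \<beta> (Suc i). xpow \<beta>)
    = X (Suc i) * (\<Sum>\<beta> | \<beta> \<in> C \<and> 0 < lk \<beta> i \<and> lk \<beta> (Suc i) = 0.
        xpow \<beta> - xpow (act (simple_transp i) \<beta>))"
proof -
  let ?e = "\<lambda>k. Poly_Mapping.single k (1::nat)"
  let ?j = "Suc i"
  let ?P = "{\<beta> \<in> C. 0 < lk \<beta> i}" and ?Q = "{\<beta> \<in> C. 0 < lk \<beta> ?j}"
  let ?PZ = "{\<beta> \<in> C. 0 < lk \<beta> i \<and> lk \<beta> ?j = 0}" and ?QZ = "{\<beta> \<in> C. 0 < lk \<beta> ?j \<and> lk \<beta> i = 0}"
  let ?R = "{\<beta> \<in> C. 0 < lk \<beta> i \<and> 0 < lk \<beta> ?j}"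
  have "(\<Sum>\<beta>\<in>?Q. xpow (\<beta> + ?e i)) = (\<Sum>\<beta>\<in>?P. xpow (\<beta> + ?e ?j))"
  proof (rule sum.reindex_bij_witness[of _ "\<lambda>\<beta>. \<beta> + ?e ?j - ?e i" "\<lambda>\<beta>. \<beta> + ?e i - ?e ?j"])
    fix \<beta>
    show "\<beta> + ?e i - ?e ?j + ?e ?j - ?e i = \<beta>" if "\<beta> \<in> ?Q"
      using that by (intro poly_mapping_eqI) (auto simp: lookup_add lookup_minus lookup_single when_def)
    show "\<beta> + ?e i - ?e ?j \<in> ?P" if "\<beta> \<in> ?Q"
    proof -
      have "\<beta> + ?e i - ?e ?j \<in> C"
      proof (rule closed)
        show "\<beta> \<in> C" using that by simp
        show "lk \<beta> i + lk \<beta> ?j = lk (\<beta> + ?e i - ?e ?j) i + lk (\<beta> + ?e i - ?e ?j) ?j"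
          using that by (simp add: lookup_add lookup_minus lookup_single)
      qed (simp add: lookup_add lookup_minus lookup_single)
      then show ?thesis by (simp add: lookup_add lookup_minus lookup_single)
    qed
    show "\<beta> + ?e ?j - ?e i + ?e i - ?e ?j = \<beta>" if "\<beta> \<in> ?P"
      using that by (intro poly_mapping_eqI) (auto simp: lookup_add lookup_minus lookup_single when_def)
    show "\<beta> + ?e ?j - ?e i \<in> ?Q" if "\<beta> \<in> ?P"
    proof -
      have "\<beta> + ?e ?j - ?e i \<in> C"
      proof (rule closed)
        show "\<beta> \<in> C" using that by simp
        show "lk \<beta> i + lk \<beta> ?j = lk (\<beta> + ?e ?j - ?e i) i + lk (\<beta> + ?e ?j - ?e i) ?j"
          using that by (simp add: lookup_add lookup_minus lookup_single)
      qed (simp add: lookup_add lookup_minus lookup_single)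
      then show ?thesis by (simp add: lookup_add lookup_minus lookup_single)
    qed
    show "xpow (\<beta> + ?e i - ?e ?j + ?e ?j) = xpow (\<beta> + ?e i)" if "\<beta> \<in> ?Q"
    proof -
      have "\<beta> + ?e i - ?e ?j + ?e ?j = \<beta> + ?e i"
        using that by (intro poly_mapping_eqI) (auto simp: lookup_add lookup_minus lookup_single when_def)
      then show ?thesis by simp
    qed
  qed
  then have shift: "X i * sum xpow ?Q = X ?j * sum xpow ?P"
    by (simp add: sum_distrib_left X_mult_xpow)
  have P: "sum xpow ?P = sum xpow ?PZ + sum xpow ?R"
    using fin by (subst sum.union_disjoint[symmetric]) (auto intro: sum.cong)
  have Q: "sum xpow ?Q = sum xpow ?QZ + sum xpow ?R"
    using fin by (subst sum.union_disjoint[symmetric]) (auto intro: sum.cong)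
  have invol: "act (simple_transp i) (act (simple_transp i) \<beta>) = \<beta>" for \<beta>
    by (rule poly_mapping_eqI) (simp add: lookup_act_transp)
  have mem: "act (simple_transp i) \<beta> \<in> C" if "\<beta> \<in> C" for \<beta>
    using that by (rule closed) (auto simp: lookup_act_transp)
  \<comment> \<open>Once the common part \<open>?R\<close> has cancelled, exchanging the two entries
    matches \<open>?PZ\<close> with \<open>?QZ\<close>.\<close>
  have "sum xpow ?QZ = (\<Sum>\<beta>\<in>?PZ. xpow (act (simple_transp i) \<beta>))"
    by (rule sum.reindex_bij_witness[of _ "act (simple_transp i)" "act (simple_transp i)"])
      (auto simp: invol mem lookup_act_transp)
  then have "sum xpow ?P - sum xpow ?Q = (\<Sum>\<beta>\<in>?PZ. xpow \<beta> - xpow (act (simple_transp i) \<beta>))"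
    by (simp add: P Q sum_subtractf)
  with shift show ?thesis
    by (simp add: left_diff_distrib right_diff_distrib[symmetric])
qed

text \<open>Both block sets are compared with a larger set \<open>C\<close> that leaves the split
  between positions \<open>i\<close> and \<open>Suc i\<close> free. The target is the part of
  \<open>C\<close> with positive entry at \<open>Suc i\<close>; the part of the source not fixed by
  \<open>qs_transp\<close> lies in \<open>C\<close> with that entry zero.\<close>

lemma theta_op_block_sum:
  assumes i: "i \<in> {1..<n}" and pos: "0 < lk \<gamma> i" and zero: "lk \<gamma> (Suc i) = 0"
  shows "theta_op i (\<Sum>\<beta>\<in>block_set n \<gamma>. xpow \<beta>)
    = (\<Sum>\<beta>\<in>block_set n (act (simple_transp i) \<gamma>). xpow \<beta>)"
proof -
  let ?K = "Poly_Mapping.keys \<gamma>"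
  let ?\<delta> = "act (simple_transp i) \<gamma>"
  \<comment> \<open>The condition at the key \<open>i\<close> is dropped and the partial sum is
    prescribed at \<open>Suc i\<close> instead, which makes \<open>C\<close> closed under
    redistribution between the two positions.\<close>
  define C where "C = {\<beta>. weak_composition n \<beta> \<and>
    (\<forall>q\<in>?K - {i}. 0 < lk \<beta> q \<and> psum \<beta> q = psum \<gamma> q) \<and>
    psum \<beta> (Suc i) = psum \<gamma> (Suc i) \<and> psum \<beta> n = psum \<gamma> n}"
  have i1: "1 \<le> i" "i < n" using i by auto
  have psum_\<delta>: "psum ?\<delta> j = psum \<gamma> j" if "j \<noteq> i" for j
    by (rule psum_eq[OF i1(1) _ _ that]) (auto simp: lookup_act_transp)
  have "?K - {i} \<union> {Suc i} = Poly_Mapping.keys ?\<delta>"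
    using pos zero by (auto simp: in_keys_iff lookup_act_transp transpose_def split: if_splits)
  then have keys_\<delta>: "Poly_Mapping.keys ?\<delta> = insert (Suc i) (?K - {i})" by simp
  have B\<delta>: "block_set n ?\<delta> = {\<beta> \<in> C. 0 < lk \<beta> (Suc i)}"
    using i1 psum_\<delta> unfolding block_set_def C_def keys_\<delta> by (auto simp del: psum_Suc)
  have iK: "?K = insert i (?K - {i})" and SiK: "Suc i \<notin> ?K"
    using pos zero by (auto simp: in_keys_iff)
  \<comment> \<open>When the entry at \<open>Suc i\<close> is zero, the partial sums at
    \<open>i\<close> and \<open>Suc i\<close> coincide, so the dropped condition on the partial sum
    at \<open>i\<close> is recovered.\<close>
  have B\<gamma>: "{\<beta> \<in> block_set n \<gamma>. lk \<beta> (Suc i) = 0} = {\<beta> \<in> C. 0 < lk \<beta> i \<and> lk \<beta> (Suc i) = 0}"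
    unfolding block_set_def C_def by (subst iK) (auto simp: zero)
  have "finite C"
    by (rule finite_subset[OF _ finite_psum_eq[of n "psum \<gamma> n"]]) (auto simp: C_def)
  moreover have "\<nu> \<in> C" if \<mu>: "\<mu> \<in> C" and s: "lk \<mu> i + lk \<mu> (Suc i) = lk \<nu> i + lk \<nu> (Suc i)"
    and r: "\<And>k. k \<noteq> i \<Longrightarrow> k \<noteq> Suc i \<Longrightarrow> lk \<mu> k = lk \<nu> k" for \<mu> \<nu>
  proof -
    have ps: "psum \<nu> j = psum \<mu> j" if "j \<noteq> i" for j
      using psum_eq[OF i1(1) s r that] by simp
    have "k \<in> {1..n}" if "k \<in> Poly_Mapping.keys \<nu>" for k
    proof (cases "k = i \<or> k = Suc i")
      case False
      then have "k \<in> Poly_Mapping.keys \<mu>" using that r by (simp add: in_keys_iff)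
      then show ?thesis using \<mu> by (auto simp: C_def weak_composition_def)
    qed (use i1 in auto)
    then have "weak_composition n \<nu>" by (auto simp: weak_composition_def)
    moreover have "0 < lk \<nu> q \<and> psum \<nu> q = psum \<gamma> q" if "q \<in> ?K - {i}" for q
    proof -
      have "q \<noteq> i" "q \<noteq> Suc i" using that SiK by auto
      moreover have "0 < lk \<mu> q \<and> psum \<mu> q = psum \<gamma> q"
        using that \<mu> unfolding C_def by blast
      ultimately show ?thesis using r[of q] ps[of q] by simp
    qed
    moreover have "psum \<nu> (Suc i) = psum \<gamma> (Suc i)" "psum \<nu> n = psum \<gamma> n"
      using \<mu> ps[of "Suc i"] ps[of n] i1 by (simp_all add: C_def del: psum_Suc)
    ultimately show ?thesis by (simp add: C_def del: psum_Suc)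
  qed
  ultimately have "(X i - X (Suc i)) * (\<Sum>\<beta>\<in>block_set n ?\<delta>. xpow \<beta>)
    = X (Suc i) * (\<Sum>\<beta> | \<beta> \<in> C \<and> 0 < lk \<beta> i \<and> lk \<beta> (Suc i) = 0.
        xpow \<beta> - xpow (act (simple_transp i) \<beta>))"
    unfolding B\<delta> by (rule X_diff_mult_sum_xpow)
  also have "(\<Sum>\<beta> | \<beta> \<in> C \<and> 0 < lk \<beta> i \<and> lk \<beta> (Suc i) = 0.
        xpow \<beta> - xpow (act (simple_transp i) \<beta>))
    = (\<Sum>\<beta>\<in>block_set n \<gamma>. xpow \<beta> - xpow (qs_transp i \<beta>))"
  proof (rule sum.mono_neutral_cong_left)
    \<comment> \<open>The remaining members are positive at both positions, so
      \<open>qs_transp\<close> fixes them and their terms vanish.\<close>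
    show "\<forall>\<beta>\<in>block_set n \<gamma> - {\<beta> \<in> C. 0 < lk \<beta> i \<and> lk \<beta> (Suc i) = 0}.
        xpow \<beta> - xpow (qs_transp i \<beta>) = 0"
      unfolding B\<gamma>[symmetric] using pos
      by (auto simp: block_set_def qs_transp_def in_keys_iff)
  qed (use B\<gamma> finite_block_set in \<open>auto simp: qs_transp_def\<close>)
  also have "X (Suc i) * \<dots> = (X i - X (Suc i)) * theta_op i (\<Sum>\<beta>\<in>block_set n \<gamma>. xpow \<beta>)"
    using finite_block_set by (rule theta_op_sum_xpow[symmetric])
  finally show ?thesis
    using X_diff_nonzero[of i] by (metis mult_left_cancel)
qed

text \<open>The hypothesis says that the rise of \<open>key_sum\<close> attains the upper bound of
  \<open>key_sum_act_word_le\<close>. As the tail rises by at most its length, the first letter must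
  rise by one, which is exactly the situation of \<open>theta_op_block_sum\<close>.\<close>

lemma theta_word_block_sum:
  assumes "set is \<subseteq> {1..<n}" "key_sum \<gamma> + length is \<le> key_sum (act (word_perm is) \<gamma>)"
  shows "theta_word is (\<Sum>\<beta>\<in>block_set n \<gamma>. xpow \<beta>)
    = (\<Sum>\<beta>\<in>block_set n (act (word_perm is) \<gamma>). xpow \<beta>)"
  using assms
proof (induction "is")
  case Nil
  then show ?case by (simp add: theta_word_def act_word_Nil)
next
  case (Cons i "is")
  let ?\<delta> = "act (word_perm is) \<gamma>"
  have "key_sum \<gamma> + Suc (length is) \<le> key_sum (act (simple_transp i) ?\<delta>)"
    using Cons.prems(2) by (simp add: act_word_Cons)
  then have "key_sum \<gamma> + length is \<le> key_sum ?\<delta>" "0 < lk ?\<delta> i" "lk ?\<delta> (Suc i) = 0"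
    using key_sum_act_transp[of i ?\<delta>] key_sum_act_word_le[of "is" \<gamma>] by (simp_all split: if_splits)
  then show ?case
    using Cons.IH Cons.prems(1) theta_op_block_sum[of i n ?\<delta>]
    by (simp add: theta_word_def act_word_Cons)
qed

theorem mainTheorem3:
  fixes n :: nat and \<alpha> :: expvec
  assumes "weak_composition n \<alpha>"
  shows "fundamental_atom n \<alpha> =
    (\<Sum>\<beta> | weak_composition n \<beta> \<and> dominated n \<alpha> \<beta> \<and> dominated n \<beta> (qshift \<alpha>). xpow \<beta>)"
proof -
  let ?W = "w_comp n \<alpha>"
  obtain js k where js: "set js \<subseteq> {1..<n}" "act (word_perm js) \<alpha> = flat \<alpha>"
    and k: "Poly_Mapping.keys (flat \<alpha>) = {1..k}"
    and len: "key_sum \<alpha> = key_sum (flat \<alpha>) + length js"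
    using ex_sorting_word[OF assms] by blast
  have "word_perm js permutes {1..n} \<and> act (word_perm js) \<alpha> = flat \<alpha>"
    using word_perm_permutes[OF js(1)] js(2) by blast
  note W = arg_min_nat_lemma[of "\<lambda>w. w permutes {1..n} \<and> act w \<alpha> = flat \<alpha>", OF this,
      of "perm_length n", folded w_comp_def]
  have perm: "?W permutes {1..n}" and act_W: "act ?W \<alpha> = flat \<alpha>"
    using W by auto
  \<comment> \<open>The sorting word represents a competitor in the minimization that defines
    \<open>w_comp\<close>.\<close>
  have "perm_length n ?W \<le> length js"
    using W js(2) word_perm_permutes[OF js(1)] perm_length_le[OF js(1)] le_trans by blast
  then have short: "perm_length n (inv ?W) \<le> length js"
    using perm_length_inv_le[OF perm] by linarith
  \<comment> \<open>This is the very word selected inside \<open>theta_perm\<close>, so independence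
    of the reduced word is not called upon.\<close>
  define "is" where "is = (SOME is. reduced_word n (inv ?W) is)"
  have "reduced_word n (inv ?W) is"
    unfolding is_def using ex_reduced_word[OF permutes_inv[OF perm]] by (rule someI_ex)
  then have "is": "set is \<subseteq> {1..<n}" "word_perm is = inv ?W" "length is \<le> length js"
    using short by (auto simp: reduced_word_def)
  have act_is: "act (word_perm is) (flat \<alpha>) = \<alpha>"
    using act_inv_eq[OF permutes_bij[OF perm] act_W] by (simp add: "is")
  have "weak_composition n (flat \<alpha>)"
    using weak_composition_act_word[OF assms js(1)] js(2) by simp
  then have "fundamental_atom n \<alpha> = theta_word is (\<Sum>\<beta>\<in>block_set n (flat \<alpha>). xpow \<beta>)"
    by (simp add: fundamental_atom_def theta_perm_def is_def block_set_initial_segment[OF _ k])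
  also have "\<dots> = (\<Sum>\<beta>\<in>block_set n \<alpha>. xpow \<beta>)"
    \<comment> \<open>By \<open>len\<close>, the rise from \<open>flat \<alpha>\<close> to
      \<open>\<alpha>\<close> is \<open>length js\<close>, hence at least
      \<open>length is\<close>.\<close>
    using theta_word_block_sum[OF "is"(1), of "flat \<alpha>"] len "is"(3) by (simp add: act_is)
  finally show ?thesis
    by (simp add: dominance_interval_eq_block_set[OF assms])
qed

end
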